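(* For every integer $d\geq 16$ and every $\varepsilon\in(0,1/100)$, there is a graph $G$ with VC-dimension $d$ such that any equitable partition of the vertex set of $G$ with the property that all but an $\varepsilon$-fraction of the pairs of parts are $\varepsilon$-homogeneous has at least $(5\varepsilon)^{-d/4}$ parts.
   Context: For a graph $G=(V,E)$ and $v\in V$, $N(v)$ is the set of neighbors of $v$. The VC-dimension of $G$ is the largest $d$ such that some $d$-element $S\subset V$ satisfies: for every $B\subset S$ there is $v\in V$ with $N(v)\cap S=B$. A partition is equitable if any two parts differ in size by at most one. A pair of disjoint vertex sets $(X,Y)$ is $\varepsilon$-homogeneous if the number of edges between $X$ and $Y$ divided by $|X||Y|$ is less than $\varepsilon$ or greater than $1-\varepsilon$. The fraction is taken over the unordered pairs of distinct parts. *)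

theory Defs
  imports Complex_Main "HOL-Library.Disjoint_Sets"
begin

definition finite_simple_graph :: "'a set \<Rightarrow> 'a set set \<Rightarrow> bool" where
  "finite_simple_graph V E \<longleftrightarrow> finite V \<and> (\<forall>e\<in>E. e \<subseteq> V \<and> card e = 2)"

definition neighbors :: "'a set \<Rightarrow> 'a set set \<Rightarrow> 'a \<Rightarrow> 'a set" where
  "neighbors V E v = {u \<in> V. {v, u} \<in> E}"

definition shattered :: "'a set \<Rightarrow> 'a set set \<Rightarrow> 'a set \<Rightarrow> bool" where
  "shattered V E S \<longleftrightarrow> S \<subseteq> V \<and> (\<forall>B. B \<subseteq> S \<longrightarrow> (\<exists>v\<in>V. neighbors V E v \<inter> S = B))"

(* Stated as a relation rather than a maximum, so that the graph without
   vertices (in which no set, not even the empty one, is shattered) has no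
   VC-dimension instead of an unspecified one. *)
definition has_vc_dim :: "'a set \<Rightarrow> 'a set set \<Rightarrow> nat \<Rightarrow> bool" where
  "has_vc_dim V E d \<longleftrightarrow>
     (\<exists>S. shattered V E S \<and> card S = d) \<and> (\<forall>S. shattered V E S \<longrightarrow> card S \<le> d)"

definition equitable_partition :: "'a set \<Rightarrow> 'a set set \<Rightarrow> bool" where
  "equitable_partition V P \<longleftrightarrow>
     partition_on V P \<and> (\<forall>X\<in>P. \<forall>Y\<in>P. card X \<le> card Y + 1)"

definition edges_between :: "'a set set \<Rightarrow> 'a set \<Rightarrow> 'a set \<Rightarrow> 'a set set" where
  "edges_between E X Y = {e \<in> E. \<exists>x\<in>X. \<exists>y\<in>Y. e = {x, y}}"

definition edge_density :: "'a set set \<Rightarrow> 'a set \<Rightarrow> 'a set \<Rightarrow> real" where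
  "edge_density E X Y = real (card (edges_between E X Y)) / (real (card X) * real (card Y))"

(* Only meant for disjoint nonempty X and Y, such as two distinct parts of a partition. *)
definition homogeneous :: "'a set set \<Rightarrow> real \<Rightarrow> 'a set \<Rightarrow> 'a set \<Rightarrow> bool" where
  "homogeneous E \<epsilon> X Y \<longleftrightarrow> edge_density E X Y < \<epsilon> \<or> edge_density E X Y > 1 - \<epsilon>"

definition part_pairs :: "'a set set \<Rightarrow> 'a set set set" where
  "part_pairs P = {{X, Y} | X Y. X \<in> P \<and> Y \<in> P \<and> X \<noteq> Y}"

definition inhomogeneous_pairs :: "'a set set \<Rightarrow> real \<Rightarrow> 'a set set \<Rightarrow> 'a set set set" where
  "inhomogeneous_pairs E \<epsilon> P =
     {{X, Y} | X Y. X \<in> P \<and> Y \<in> P \<and> X \<noteq> Y \<and> \<not> homogeneous E \<epsilon> X Y}"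

(* The fraction of pairs is meaningful only if there is a pair of parts at all,
   hence the requirement of at least two parts. Without it the one-part
   partition would qualify vacuously for every graph. *)
definition almost_all_pairs_homogeneous :: "'a set set \<Rightarrow> real \<Rightarrow> 'a set set \<Rightarrow> bool" where
  "almost_all_pairs_homogeneous E \<epsilon> P \<longleftrightarrow>
     card P \<ge> 2 \<and>
     real (card (inhomogeneous_pairs E \<epsilon> P)) / real (card (part_pairs P)) \<le> \<epsilon>"

end

theory Submission imports Defs "HOL-Library.Nat_Bijection" begin

text \<open>
  Let p = 3\<epsilon> and take the random graph on about p^{-(d/2+1)} vertices with edge probability p.
  If a + k = d + 1, a shattered set of size d + 1 yields a vertices with 2^k common neighbors
  outside of them. For k about d/4 the expected number of such configurations is below 1/2.
  On the other hand, by a Chernoff bound and a union bound over all pairs of vertex sets, any two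
  disjoint sets whose size is close to that of a part in a partition into fewer than
  (5\<epsilon>)^{-d/4} parts have density strictly between 5\<epsilon>/4 and 1/2. So some graph has
  VC-dimension at most d and no homogeneous pairs of parts. Adding a disjoint bipartite graph on
  d + 2^d vertices that shatters a set of size d makes the VC-dimension exactly d, and it
  meets every part in too few vertices to create homogeneous pairs.
\<close>

section \<open>Edge sets between disjoint vertex sets\<close>

text \<open>For disjoint \<open>X\<close> and \<open>Y\<close>,
  \<open>edges_between UNIV X Y\<close> is the edge set of the complete bipartite graph between
  them. Intersecting with this fixed set turns the number of edges of a random \<open>E\<close>
  between \<open>X\<close> and \<open>Y\<close> into a binomial count.\<close>

lemma edges_between_Int_UNIV: "edges_between E X Y = E \<inter> edges_between UNIV X Y"
  by (auto simp: edges_between_def)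

lemma edges_between_UNIV_image: "edges_between UNIV X Y = (\<lambda>(x, y). {x, y}) ` (X \<times> Y)"
  by (auto simp: edges_between_def)

lemma finite_edges_between:
  assumes "finite X" "finite Y"
  shows "finite (edges_between E X Y)"
  by (subst edges_between_Int_UNIV) (simp add: assms edges_between_UNIV_image)

lemma card_edges_between_UNIV_le:
  assumes "finite X" "finite Y"
  shows "card (edges_between UNIV X Y) \<le> card X * card Y"
  unfolding edges_between_UNIV_image card_cartesian_product[symmetric]
  by (rule card_image_le) (simp add: assms)

text \<open>Disjointness makes an unordered pair remember which end lies in \<open>X\<close>, so
  distinct ordered pairs give distinct edges.\<close>

lemma card_edges_between_UNIV:
  assumes "X \<inter> Y = {}"
  shows "card (edges_between UNIV X Y) = card X * card Y"
proof -
  have "inj_on (\<lambda>(x, y). {x, y}) (X \<times> Y)"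
    using assms by (auto simp: inj_on_def doubleton_eq_iff)
  then show ?thesis
    unfolding edges_between_UNIV_image by (simp add: card_image card_cartesian_product)
qed

section \<open>Random subsets\<close>

text \<open>For \<open>E \<subseteq> N\<close>, this is the probability that a random subset of
  \<open>N\<close>, containing each element independently with probability \<open>p\<close>, equals
  \<open>E\<close>. Probabilities of events are finite sums of these weights over subsets of
  \<open>Pow N\<close>.\<close>

definition random_weight :: "real \<Rightarrow> 'b set \<Rightarrow> 'b set \<Rightarrow> real" where
  "random_weight p N E = p ^ card E * (1 - p) ^ card (N - E)"

lemma random_weight_nonneg: "0 \<le> p \<Longrightarrow> p \<le> 1 \<Longrightarrow> 0 \<le> random_weight p N E"
  by (simp add: random_weight_def)

text \<open>The generating function of a binomial variable. Expanding a product over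
  \<open>N\<close> of two-term factors, one term for choosing an element and one for omitting it,
  gives the sum over all subsets; elements outside \<open>F\<close> contribute the factor 1.\<close>

lemma sum_random_weight_power:
  assumes "finite N" "F \<subseteq> N"
  shows "(\<Sum>E\<in>Pow N. random_weight p N E * t ^ card (E \<inter> F)) = (1 - p + p * t) ^ card F"
proof -
  have fin: "finite F" using assms finite_subset by blast
  have "(\<Sum>E\<in>Pow N. random_weight p N E * t ^ card (E \<inter> F))
      = (\<Sum>E\<in>Pow N. (\<Prod>e\<in>E. p * (if e \<in> F then t else 1)) * (\<Prod>e\<in>N - E. 1 - p))"
  proof (rule sum.cong[OF refl])
    fix E assume "E \<in> Pow N"
    then have "finite E" using assms(1) finite_subset by blast
    then show "random_weight p N E * t ^ card (E \<inter> F)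
      = (\<Prod>e\<in>E. p * (if e \<in> F then t else 1)) * (\<Prod>e\<in>N - E. 1 - p)"
      by (simp add: random_weight_def prod.distrib prod.inter_restrict[symmetric])
  qed
  also have "\<dots> = (\<Prod>e\<in>N. p * (if e \<in> F then t else 1) + (1 - p))"
    by (rule prod_add[OF assms(1), symmetric])
  also have "\<dots> = (\<Prod>e\<in>N. if e \<in> F then 1 - p + p * t else 1)"
    by (rule prod.cong) auto
  also have "\<dots> = (1 - p + p * t) ^ card (N \<inter> F)"
    using assms(1) by (simp add: prod.inter_restrict[symmetric])
  also have "N \<inter> F = F" using assms by blast
  finally show ?thesis .
qed

lemma sum_random_weight:
  assumes "finite N"
  shows "(\<Sum>E\<in>Pow N. random_weight p N E) = 1"
  using sum_random_weight_power[OF assms, of "{}" p 1] by simp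

text \<open>The same product expansion, but omitting an element of \<open>F\<close> now costs the
  factor 0, which removes every \<open>E\<close> that does not contain \<open>F\<close>.\<close>

lemma sum_random_weight_superset:
  assumes "finite N" "F \<subseteq> N"
  shows "(\<Sum>E | E \<in> Pow N \<and> F \<subseteq> E. random_weight p N E) = p ^ card F"
proof -
  have "(\<Sum>E | E \<in> Pow N \<and> F \<subseteq> E. random_weight p N E)
      = (\<Sum>E\<in>Pow N. if F \<subseteq> E then random_weight p N E else 0)"
    using assms by (subst sum.inter_filter[symmetric]) auto
  also have "\<dots> = (\<Sum>E\<in>Pow N. (\<Prod>e\<in>E. p) * (\<Prod>e\<in>N - E. if e \<in> F then 0 else 1 - p))"
  proof (rule sum.cong[OF refl])
    fix E assume E: "E \<in> Pow N"
    show "(if F \<subseteq> E then random_weight p N E else 0)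
      = (\<Prod>e\<in>E. p) * (\<Prod>e\<in>N - E. if e \<in> F then 0 else 1 - p)"
    proof (cases "F \<subseteq> E")
      case True
      then have "(\<Prod>e\<in>N - E. if e \<in> F then 0 else 1 - p) = (\<Prod>e\<in>N - E. 1 - p)"
        by (intro prod.cong) auto
      then show ?thesis using True by (simp add: random_weight_def)
    next
      case False
      then obtain e where "e \<in> F" "e \<notin> E" by blast
      then have "(\<Prod>e\<in>N - E. if e \<in> F then 0 else 1 - p) = 0"
        using assms by (intro prod_zero) auto
      then show ?thesis using False by simp
    qed
  qed
  also have "\<dots> = (\<Prod>e\<in>N. p + (if e \<in> F then 0 else 1 - p))"
    by (rule prod_add[OF assms(1), symmetric])
  also have "\<dots> = (\<Prod>e\<in>N. if e \<in> F then p else 1)"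
    by (rule prod.cong) auto
  also have "\<dots> = p ^ card (N \<inter> F)"
    using assms(1) by (simp add: prod.inter_restrict[symmetric])
  also have "N \<inter> F = F" using assms by blast
  finally show ?thesis .
qed

section \<open>Exponential moments and Chernoff-type tail bounds\<close>

lemma random_weight_markov:
  assumes "finite N" "F \<subseteq> N" "0 \<le> p" "p \<le> 1" "0 \<le> t" "0 \<le> C"
    and "\<And>E. Q E \<Longrightarrow> 1 \<le> C * t ^ card (E \<inter> F)"
  shows "(\<Sum>E | E \<in> Pow N \<and> Q E. random_weight p N E) \<le> C * (1 - p + p * t) ^ card F"
proof -
  have "(\<Sum>E | E \<in> Pow N \<and> Q E. random_weight p N E)
      \<le> (\<Sum>E | E \<in> Pow N \<and> Q E. C * (random_weight p N E * t ^ card (E \<inter> F)))"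
  proof (rule sum_mono)
    fix E assume "E \<in> {E. E \<in> Pow N \<and> Q E}"
    then have "random_weight p N E * 1 \<le> random_weight p N E * (C * t ^ card (E \<inter> F))"
      using assms by (intro mult_left_mono random_weight_nonneg) auto
    then show "random_weight p N E \<le> C * (random_weight p N E * t ^ card (E \<inter> F))"
      by (simp add: mult_ac)
  qed
  also have "\<dots> \<le> (\<Sum>E\<in>Pow N. C * (random_weight p N E * t ^ card (E \<inter> F)))"
    using assms by (intro sum_mono2) (auto simp: random_weight_nonneg)
  also have "\<dots> = C * (1 - p + p * t) ^ card F"
    using sum_random_weight_power[OF assms(1,2), of p t] by (simp add: sum_distrib_left[symmetric])
  finally show ?thesis .
qed

text \<open>Markov's inequality with \<open>t = 1 / 2\<close>. The mean of the count is
  \<open>3 * \<epsilon> * card F\<close>. In units of \<open>\<epsilon> * card F\<close> the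
  exponent is at most 5/4 times 4/5 minus 3/2, that is -1/2, where 4/5 bounds
  \<open>ln 2\<close>.\<close>

lemma lower_tail_bound:
  assumes "finite N" "F \<subseteq> N" "0 < \<epsilon>" "\<epsilon> < 1 / 100"
  shows "(\<Sum>E | E \<in> Pow N \<and> real (card (E \<inter> F)) \<le> 5 / 4 * \<epsilon> * card F. random_weight (3 * \<epsilon>) N E)
    \<le> exp (- (\<epsilon> * card F / 2))"
proof -
  let ?c = "5 / 4 * \<epsilon> * card F"
  have "(\<Sum>E | E \<in> Pow N \<and> real (card (E \<inter> F)) \<le> ?c. random_weight (3 * \<epsilon>) N E)
      \<le> 2 powr ?c * (1 - 3 * \<epsilon> + 3 * \<epsilon> * (1 / 2)) ^ card F"
  proof (rule random_weight_markov)
    fix E assume "real (card (E \<inter> F)) \<le> ?c"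
    then have "2 powr real (card (E \<inter> F)) \<le> 2 powr ?c" by simp
    then show "1 \<le> 2 powr ?c * (1 / 2) ^ card (E \<inter> F)"
      by (simp add: powr_realpow power_divide)
  qed (use assms in auto)
  also have "\<dots> \<le> exp (\<epsilon> * card F) * exp (- (3 / 2 * \<epsilon>)) ^ card F"
  proof (intro mult_mono power_mono)
    have "(2::real) \<le> exp (4 / 5)"
      using exp_lower_Taylor_quadratic[of "4 / 5"] by (simp add: power2_eq_square)
    then have "ln (2::real) \<le> 4 / 5" by (metis exp_gt_zero ln_exp ln_le_cancel_iff zero_less_numeral)
    then have "?c * ln 2 \<le> ?c * (4 / 5)" using assms by (intro mult_left_mono) auto
    then show "2 powr ?c \<le> exp (\<epsilon> * card F)" by (simp add: powr_def)
    show "1 - 3 * \<epsilon> + 3 * \<epsilon> * (1 / 2) \<le> exp (- (3 / 2 * \<epsilon>))"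
      using exp_ge_add_one_self[of "- (3 / 2 * \<epsilon>)"] by linarith
  qed (use assms in auto)
  also have "\<dots> = exp (- (\<epsilon> * card F / 2))"
    by (simp add: exp_of_nat_mult[symmetric] exp_add[symmetric] algebra_simps)
  finally show ?thesis .
qed

text \<open>Markov's inequality with \<open>t = 9\<close>, since the event forces
  \<open>9 ^ card (E \<inter> F)\<close> to be at least \<open>3 ^ card F\<close>. The resulting
  base is close to 1/3; it is weakened to the same rate as the lower tail.\<close>

lemma upper_tail_bound:
  assumes "finite N" "F \<subseteq> N" "0 < \<epsilon>" "\<epsilon> < 1 / 100"
  shows "(\<Sum>E | E \<in> Pow N \<and> real (card F) \<le> 2 * card (E \<inter> F). random_weight (3 * \<epsilon>) N E)
    \<le> exp (- (\<epsilon> * card F / 2))"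
proof -
  have "(\<Sum>E | E \<in> Pow N \<and> real (card F) \<le> 2 * card (E \<inter> F). random_weight (3 * \<epsilon>) N E)
      \<le> (1 / 3) ^ card F * (1 - 3 * \<epsilon> + 3 * \<epsilon> * 9) ^ card F"
  proof (rule random_weight_markov)
    fix E assume "real (card F) \<le> 2 * card (E \<inter> F)"
    then have "(3::real) ^ card F \<le> 3 ^ (2 * card (E \<inter> F))" by (intro power_increasing) linarith+
    then show "1 \<le> (1 / 3) ^ card F * (9::real) ^ card (E \<inter> F)"
      by (simp add: power_divide power_mult)
  qed (use assms in auto)
  also have "\<dots> = ((1 - 3 * \<epsilon> + 3 * \<epsilon> * 9) / 3) ^ card F"
    by (simp add: power_divide)
  also have "\<dots> \<le> exp (- (\<epsilon> / 2)) ^ card F"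
  proof (rule power_mono)
    have "(1 - 3 * \<epsilon> + 3 * \<epsilon> * 9) / 3 \<le> 1 + - (\<epsilon> / 2)" using assms by simp
    also have "\<dots> \<le> exp (- (\<epsilon> / 2))" by (rule exp_ge_add_one_self)
    finally show "(1 - 3 * \<epsilon> + 3 * \<epsilon> * 9) / 3 \<le> exp (- (\<epsilon> / 2))" .
  qed (use assms in simp)
  also have "\<dots> = exp (- (\<epsilon> * card F / 2))"
    by (simp add: exp_of_nat_mult[symmetric] mult_ac)
  finally show ?thesis .
qed

section \<open>Union bound and existence of the random graph\<close>

lemma sum_Union_le:
  fixes w :: "'b \<Rightarrow> real" and c :: real
  assumes "finite I" "\<And>i. i \<in> I \<Longrightarrow> finite (A i)" "\<And>x. 0 \<le> w x"
    and "\<And>i. i \<in> I \<Longrightarrow> sum w (A i) \<le> c"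
  shows "sum w (\<Union>i\<in>I. A i) \<le> card I * c"
proof -
  have "sum w (\<Union>i\<in>I. A i) \<le> (\<Sum>i\<in>I. sum w (A i))"
    using assms(1-3)
  proof (induction I rule: finite_induct)
    case (insert i I)
    have "sum w (A i \<union> (\<Union>i\<in>I. A i)) \<le> sum w (A i) + sum w (\<Union>i\<in>I. A i)"
      using insert by (subst sum.union_inter[symmetric]) (auto intro: sum_nonneg)
    then show ?case using insert by fastforce
  qed simp
  also have "\<dots> \<le> card I * c" using assms(4) by (rule sum_bounded_above)
  finally show ?thesis .
qed

text \<open>First-moment argument with edge probability \<open>3 * \<epsilon>\<close>. By
  \<open>few\<close>, the expected number of complete bipartite configurations of sizes
  \<open>a\<close> and \<open>b\<close> is at most 1/2. By \<open>large\<close>, each density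
  failure has probability at most \<open>exp (- (3 * n))\<close>, which beats the at most
  \<open>4 ^ n\<close> pairs of sets.\<close>

lemma exists_random_graph:
  fixes n a b :: nat and s \<epsilon> :: real
  assumes eps: "0 < \<epsilon>" "\<epsilon> < 1 / 100"
    and "2 \<le> a" "4 \<le> n" "0 \<le> s"
    and few: "real n ^ (a + b) * (3 * \<epsilon>) ^ (a * b) \<le> 1"
    and large: "3 * real n \<le> \<epsilon> * s\<^sup>2 / 2"
  obtains E where "\<forall>e\<in>E. e \<subseteq> {..<n} \<and> card e = 2"
    and "\<And>A T. A \<subseteq> {..<n} \<Longrightarrow> T \<subseteq> {..<n} \<Longrightarrow> A \<inter> T = {} \<Longrightarrow> card A = a \<Longrightarrow> card T = b \<Longrightarrow>
      \<not> edges_between UNIV A T \<subseteq> E"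
    and "\<And>X Y. X \<subseteq> {..<n} \<Longrightarrow> Y \<subseteq> {..<n} \<Longrightarrow> X \<inter> Y = {} \<Longrightarrow> s \<le> card X \<Longrightarrow> s \<le> card Y \<Longrightarrow>
      5 / 4 * \<epsilon> * (card X * card Y) < card (edges_between E X Y) \<and>
      2 * card (edges_between E X Y) < card X * card Y"
proof -
  define N where "N = {e. e \<subseteq> {..<n} \<and> card e = 2}"
  define w where "w = random_weight (3 * \<epsilon>) N"
  have N: "finite N" unfolding N_def by simp
  have w: "0 \<le> w E" for E using eps by (simp add: w_def random_weight_nonneg)
  define F :: "nat set \<times> nat set \<Rightarrow> nat set set"
    where "F = (\<lambda>(X, Y). edges_between UNIV X Y)"
  have FN: "F (X, Y) \<subseteq> N" if "X \<subseteq> {..<n}" "Y \<subseteq> {..<n}" "X \<inter> Y = {}" for X Y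
    using that by (fastforce simp: F_def N_def edges_between_def card_2_iff)
  define I where "I = {(A, T). A \<subseteq> {..<n} \<and> T \<subseteq> {..<n} \<and> A \<inter> T = {} \<and> card A = a \<and> card T = b}"
  define J where "J = {(X, Y). X \<subseteq> {..<n} \<and> Y \<subseteq> {..<n} \<and> X \<inter> Y = {} \<and> s \<le> card X \<and> s \<le> card Y}"
  \<comment> \<open>The bad events: a complete bipartite configuration is present, a pair of large
    sets is too sparse, or such a pair is too dense.\<close>
  define B1 where "B1 = (\<lambda>i. {E. E \<in> Pow N \<and> F i \<subseteq> E})"
  define B2 where "B2 = (\<lambda>j. {E. E \<in> Pow N \<and> real (card (E \<inter> F j)) \<le> 5 / 4 * \<epsilon> * card (F j)})"
  define B3 where "B3 = (\<lambda>j. {E. E \<in> Pow N \<and> real (card (F j)) \<le> 2 * card (E \<inter> F j)})"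
  have I_sub: "I \<subseteq> {A. A \<subseteq> {..<n} \<and> card A = a} \<times> {T. T \<subseteq> {..<n} \<and> card T = b}"
    by (auto simp: I_def)
  have finI: "finite I" by (rule finite_subset[OF I_sub]) simp
  have "card I \<le> (n choose a) * (n choose b)"
    using card_mono[OF _ I_sub] by (simp add: card_cartesian_product n_subsets)
  \<comment> \<open>The factor 2 comes from \<open>fact a \<ge> 2\<close>; it lowers the expected
    number of configurations from 1 to 1/2.\<close>
  also have "2 * \<dots> \<le> (fact a * (n choose a)) * (fact b * (n choose b))"
  proof -
    have "2 \<le> (fact a :: nat)" using \<open>2 \<le> a\<close> fact_ge_self[of a] by linarith
    then have "2 * 1 \<le> fact a * (fact b :: nat)" by (intro mult_le_mono) auto
    then show ?thesis
      using mult_le_mono1[of 2 "fact a * fact b" "(n choose a) * (n choose b)"]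
      by (simp add: mult_ac)
  qed
  also have "\<dots> \<le> n ^ a * n ^ b"
    using binomial_fact_pow[of n a] binomial_fact_pow[of n b]
    by (intro mult_le_mono) (simp_all add: mult.commute)
  finally have "2 * card I \<le> n ^ (a + b)" by (simp add: power_add)
  then have "2 * real (card I) \<le> real n ^ (a + b)"
    by (metis of_nat_le_iff of_nat_mult of_nat_numeral of_nat_power)
  then have "2 * real (card I) * (3 * \<epsilon>) ^ (a * b) \<le> real n ^ (a + b) * (3 * \<epsilon>) ^ (a * b)"
    using eps by (intro mult_right_mono) auto
  also note few
  finally have "2 * real (card I) * (3 * \<epsilon>) ^ (a * b) \<le> 1" .
  moreover have "sum w (\<Union>i\<in>I. B1 i) \<le> card I * (3 * \<epsilon>) ^ (a * b)"
  proof (rule sum_Union_le[OF finI])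
    fix i assume "i \<in> I"
    then have "F i \<subseteq> N" "card (F i) = a * b"
      using FN by (auto simp: I_def F_def card_edges_between_UNIV)
    then show "sum w (B1 i) \<le> (3 * \<epsilon>) ^ (a * b)"
      using sum_random_weight_superset[OF N, of "F i" "3 * \<epsilon>"] by (simp add: w_def B1_def)
  qed (use N w in \<open>auto simp: B1_def\<close>)
  ultimately have S1: "sum w (\<Union>i\<in>I. B1 i) \<le> 1 / 2" by linarith
  have J_sub: "J \<subseteq> Pow {..<n} \<times> Pow {..<n}" by (auto simp: J_def)
  have finJ: "finite J" by (rule finite_subset[OF J_sub]) simp
  have "card J \<le> 4 ^ n"
    using card_mono[OF _ J_sub]
    by (simp add: card_cartesian_product card_Pow power_mult_distrib[symmetric])
  then have "real (card J) \<le> 4 ^ n" by (metis of_nat_le_iff of_nat_numeral of_nat_power)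
  also have "\<dots> \<le> exp 2 ^ n"
  proof (rule power_mono)
    have "(2::real) * 2 \<le> exp 1 * exp 1" using exp_ge_add_one_self[of 1] by (intro mult_mono) auto
    then show "(4::real) \<le> exp 2" by (simp add: exp_add[symmetric])
  qed simp
  finally have J: "real (card J) \<le> exp (2 * n)" by (simp add: exp_of_nat_mult[symmetric] mult.commute)
  have JF: "F j \<subseteq> N" "exp (- (\<epsilon> * card (F j) / 2)) \<le> exp (- (3 * real n))" if "j \<in> J" for j
  proof -
    obtain X Y where j: "j = (X, Y)" by fastforce
    then show "F j \<subseteq> N" using that FN by (auto simp: J_def)
    have "s * s \<le> real (card X) * real (card Y)"
      using that \<open>0 \<le> s\<close> by (intro mult_mono) (auto simp: J_def j)
    also have "\<dots> = real (card (F j))"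
      using that by (simp add: j F_def J_def card_edges_between_UNIV)
    finally have "\<epsilon> * s\<^sup>2 \<le> \<epsilon> * card (F j)" using eps by (simp add: power2_eq_square)
    then show "exp (- (\<epsilon> * card (F j) / 2)) \<le> exp (- (3 * real n))" using large by simp
  qed
  \<comment> \<open>After cancelling, this is \<open>4 < exp n\<close>, which follows from
    \<open>exp n \<ge> n + 1\<close> and \<open>4 \<le> n\<close>.\<close>
  have exp_less: "4 * (exp (2 * n) * exp (- (3 * real n))) < 1"
  proof -
    have "4 < exp (real n)" using exp_ge_add_one_self[of "real n"] \<open>4 \<le> n\<close> by linarith
    then have "4 * exp (- real n) < 1" by (simp add: exp_minus field_simps)
    then show ?thesis by (simp add: exp_add[symmetric])
  qed
  have "sum w (\<Union>j\<in>J. B2 j) \<le> card J * exp (- (3 * real n))"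
  proof (rule sum_Union_le[OF finJ])
    fix j assume "j \<in> J"
    from lower_tail_bound[OF N JF(1)[OF this] eps] JF(2)[OF this]
    show "sum w (B2 j) \<le> exp (- (3 * real n))" unfolding w_def B2_def by (rule order_trans)
  qed (use N w in \<open>auto simp: B2_def\<close>)
  also have "\<dots> \<le> exp (2 * n) * exp (- (3 * real n))" using J by (intro mult_right_mono) auto
  finally have S2: "sum w (\<Union>j\<in>J. B2 j) < 1 / 4" using exp_less by linarith
  have "sum w (\<Union>j\<in>J. B3 j) \<le> card J * exp (- (3 * real n))"
  proof (rule sum_Union_le[OF finJ])
    fix j assume "j \<in> J"
    from upper_tail_bound[OF N JF(1)[OF this] eps] JF(2)[OF this]
    show "sum w (B3 j) \<le> exp (- (3 * real n))" unfolding w_def B3_def by (rule order_trans)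
  qed (use N w in \<open>auto simp: B3_def\<close>)
  also have "\<dots> \<le> exp (2 * n) * exp (- (3 * real n))" using J by (intro mult_right_mono) auto
  finally have S3: "sum w (\<Union>j\<in>J. B3 j) < 1 / 4" using exp_less by linarith
  define bad where "bad = (\<Union>i\<in>I. B1 i) \<union> (\<Union>j\<in>J. B2 j) \<union> (\<Union>j\<in>J. B3 j)"
  have un: "sum w (A \<union> B) \<le> sum w A + sum w B" if "A \<subseteq> Pow N" "B \<subseteq> Pow N" for A B
  proof -
    have "finite A" "finite B" using that N by (meson finite_Pow_iff finite_subset)+
    then have "sum w (A \<union> B) + sum w (A \<inter> B) = sum w A + sum w B" by (rule sum.union_inter)
    then show ?thesis using sum_nonneg[of "A \<inter> B" w, OF w] by linarith
  qed
  have sub: "(\<Union>i\<in>I. B1 i) \<subseteq> Pow N" "(\<Union>j\<in>J. B2 j) \<subseteq> Pow N" "(\<Union>j\<in>J. B3 j) \<subseteq> Pow N"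
    by (auto simp: B1_def B2_def B3_def)
  \<comment> \<open>The bounds 1/2, 1/4 and 1/4 add up to exactly 1; strictness of the last two
    leaves room for a good graph.\<close>
  have "sum w bad < 1"
    using un[of "(\<Union>i\<in>I. B1 i) \<union> (\<Union>j\<in>J. B2 j)" "\<Union>j\<in>J. B3 j"]
      un[of "\<Union>i\<in>I. B1 i" "\<Union>j\<in>J. B2 j"] S1 S2 S3 sub unfolding bad_def by auto
  moreover have "sum w (Pow N) = 1" unfolding w_def by (rule sum_random_weight[OF N])
  ultimately have "\<not> Pow N \<subseteq> bad"
    using sub unfolding bad_def by (metis Un_least less_irrefl subset_antisym)
  then obtain E where E: "E \<subseteq> N" "E \<notin> bad" by blast
  show ?thesis
  proof
    show "\<forall>e\<in>E. e \<subseteq> {..<n} \<and> card e = 2" using E(1) by (auto simp: N_def)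
    show "\<not> edges_between UNIV A T \<subseteq> E"
      if "A \<subseteq> {..<n}" "T \<subseteq> {..<n}" "A \<inter> T = {}" "card A = a" "card T = b" for A T
    proof -
      have "(A, T) \<in> I" using that by (simp add: I_def)
      then have "E \<notin> B1 (A, T)" using E(2) by (auto simp: bad_def)
      then show ?thesis using E(1) by (auto simp: B1_def F_def)
    qed
    show "5 / 4 * \<epsilon> * (card X * card Y) < card (edges_between E X Y) \<and>
      2 * card (edges_between E X Y) < card X * card Y"
      if X: "X \<subseteq> {..<n}" "Y \<subseteq> {..<n}" "X \<inter> Y = {}" "s \<le> card X" "s \<le> card Y" for X Y
    proof -
      have "(X, Y) \<in> J" using X by (simp add: J_def)
      then have "E \<notin> B2 (X, Y)" "E \<notin> B3 (X, Y)" using E(2) by (auto simp: bad_def)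
      moreover have "E \<inter> F (X, Y) = edges_between E X Y"
        using edges_between_Int_UNIV[of E X Y] by (simp add: F_def)
      moreover have "card (F (X, Y)) = card X * card Y"
        using X by (simp add: F_def card_edges_between_UNIV)
      ultimately have "\<not> real (card (edges_between E X Y)) \<le> 5 / 4 * \<epsilon> * (card X * card Y)"
        and "\<not> real (card X * card Y) \<le> 2 * card (edges_between E X Y)"
        using E(1) by (auto simp: B2_def B3_def)
      then show ?thesis by linarith
    qed
  qed
qed


section \<open>Forcing the VC-dimension to be exactly d\<close>

text \<open>The vertices of the incidence graph between \<open>d\<close> points and all sets of
  points. Everything is shifted to \<open>n\<close> or above to avoid the random graph;
  \<open>set_encode\<close> gives distinct finite sets distinct codes, and the summand
  \<open>d\<close> keeps these above the points.\<close>

definition gadget_vertices :: "nat \<Rightarrow> nat \<Rightarrow> nat set" where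
  "gadget_vertices n d = (+) n ` {..<d} \<union> (\<lambda>B. n + d + set_encode B) ` Pow {..<d}"

definition gadget_edges :: "nat \<Rightarrow> nat \<Rightarrow> nat set set" where
  "gadget_edges n d = {{n + i, n + d + set_encode B} | i B. B \<subseteq> {..<d} \<and> i \<in> B}"

lemma finite_gadget_vertices: "finite (gadget_vertices n d)"
  by (simp add: gadget_vertices_def)

lemma card_gadget_vertices_le: "card (gadget_vertices n d) \<le> d + 2 ^ d"
proof -
  have "card ((+) n ` {..<d}) \<le> d" using card_image_le[of "{..<d}" "(+) n"] by simp
  moreover have "card ((\<lambda>B. n + d + set_encode B) ` Pow {..<d}) \<le> 2 ^ d"
    using card_image_le[of "Pow {..<d}" "\<lambda>B. n + d + set_encode B"] by (simp add: card_Pow)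
  ultimately show ?thesis
    unfolding gadget_vertices_def by (meson add_mono card_Un_le le_trans)
qed

lemma gadget_vertices_disjoint: "gadget_vertices n d \<inter> {..<n} = {}"
  by (auto simp: gadget_vertices_def)

lemma gadget_edges_doubleton:
  "e \<in> gadget_edges n d \<Longrightarrow> e \<subseteq> gadget_vertices n d \<and> card e = 2"
  by (fastforce simp: gadget_edges_def gadget_vertices_def)

lemma gadget_edge_iff:
  assumes "B \<subseteq> {..<d}"
  shows "{n + d + set_encode B, n + i} \<in> gadget_edges n d \<longleftrightarrow> i \<in> B"
proof
  assume "{n + d + set_encode B, n + i} \<in> gadget_edges n d"
  then obtain j C where jC: "{n + d + set_encode B, n + i} = {n + j, n + d + set_encode C}"
    "C \<subseteq> {..<d}" "j \<in> C"
    by (auto simp: gadget_edges_def)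
  \<comment> \<open>This excludes the crossed matching of the two doubletons, since a point number
    is smaller than any set number.\<close>
  then have "j < d" by auto
  then have "i = j" "set_encode B = set_encode C"
    using jC(1) by (auto simp: doubleton_eq_iff)
  moreover have "finite B" "finite C" using assms jC(2) finite_subset by blast+
  ultimately show "i \<in> B" using jC(3) by (simp add: set_encode_eq)
next
  assume "i \<in> B"
  then show "{n + d + set_encode B, n + i} \<in> gadget_edges n d"
    using assms by (auto simp: gadget_edges_def insert_commute)
qed

text \<open>The points of the gadget are shattered. Conversely, a shattered set of size
  \<open>d + 1\<close> has a common neighbor, and no edge joins the two pieces, so it lies in one
  piece. In the random piece, \<open>a\<close> of its elements have \<open>2 ^ k\<close> common
  neighbors, against \<open>free\<close>. In the gadget it lies on one side of a bipartite graph
  with only \<open>d\<close> points.\<close>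

lemma has_vc_dim_gadget:
  fixes n d a k :: nat
  assumes E: "\<forall>e\<in>E. e \<subseteq> {..<n} \<and> card e = 2"
    and ak: "a + k = d + 1" "0 < a"
    and free: "\<And>A T. A \<subseteq> {..<n} \<Longrightarrow> T \<subseteq> {..<n} \<Longrightarrow> A \<inter> T = {} \<Longrightarrow> card A = a \<Longrightarrow> card T = 2 ^ k \<Longrightarrow>
      \<not> edges_between UNIV A T \<subseteq> E"
  shows "has_vc_dim ({..<n} \<union> gadget_vertices n d) (E \<union> gadget_edges n d) d"
proof -
  define V where "V = {..<n} \<union> gadget_vertices n d"
  define G where "G = E \<union> gadget_edges n d"
  have V: "finite V" by (simp add: V_def finite_gadget_vertices)
  have G: "e \<subseteq> V \<and> card e = 2" if "e \<in> G" for e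
    using that E gadget_edges_doubleton[of e n d] by (auto simp: V_def G_def)
  \<comment> \<open>No edge leaves the random piece.\<close>
  have low: "{u, v} \<in> E \<and> u < n \<and> v < n" if "{u, v} \<in> G" "u < n \<or> v < n" for u v
  proof -
    have "{u, v} \<notin> gadget_edges n d"
      using that(2) gadget_edges_doubleton[of "{u, v}" n d] gadget_vertices_disjoint[of n d] by auto
    then show ?thesis using that(1) E by (auto simp: G_def)
  qed
  have "shattered V G ((+) n ` {..<d})"
    unfolding shattered_def
  proof (intro conjI allI impI)
    show "(+) n ` {..<d} \<subseteq> V" by (auto simp: V_def gadget_vertices_def)
    fix B' assume "B' \<subseteq> (+) n ` {..<d}"
    then obtain B where B: "B \<subseteq> {..<d}" "B' = (+) n ` B" by (meson subset_imageE)
    have "{n + d + set_encode B, n + i} \<in> G \<longleftrightarrow> i \<in> B" for i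
    proof -
      have "{n + d + set_encode B, n + i} \<notin> E" using E by auto
      then show ?thesis using gadget_edge_iff[OF B(1), of n i] by (simp add: G_def)
    qed
    then have "neighbors V G (n + d + set_encode B) \<inter> (+) n ` {..<d} = B'"
      using B by (auto simp: neighbors_def V_def gadget_vertices_def)
    moreover have "n + d + set_encode B \<in> V" using B by (auto simp: V_def gadget_vertices_def)
    ultimately show "\<exists>v\<in>V. neighbors V G v \<inter> (+) n ` {..<d} = B'" by blast
  qed
  moreover have "card ((+) n ` {..<d}) = d" by (simp add: card_image)
  moreover have "card S0 \<le> d" if sh0: "shattered V G S0" for S0
  proof (rule ccontr)
    assume "\<not> card S0 \<le> d"
    then have "d + 1 \<le> card S0" by simp
    then obtain S where S: "S \<subseteq> S0" "card S = d + 1" "finite S" by (meson obtain_subset_with_card_n)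
    have "\<exists>v. \<forall>u\<in>S. {v, u} \<in> G \<longleftrightarrow> u \<in> B" if "B \<subseteq> S" for B
    proof -
      have "B \<subseteq> S0" using that S by blast
      then obtain v where v: "v \<in> V" "neighbors V G v \<inter> S0 = B" using sh0 unfolding shattered_def by blast
      moreover have "S0 \<subseteq> V" using sh0 by (simp add: shattered_def)
      ultimately show ?thesis using S(1) by (auto simp: neighbors_def)
    qed
    then obtain f where f: "\<And>B u. B \<subseteq> S \<Longrightarrow> u \<in> S \<Longrightarrow> {f B, u} \<in> G \<longleftrightarrow> u \<in> B" by metis
    \<comment> \<open>The trace of \<open>f B\<close> on \<open>S\<close> recovers \<open>B\<close>,
      so different traces come from different vertices.\<close>
    have inj_f: "inj_on f (Pow S)"
    proof (rule inj_on_inverseI)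
      show "{u \<in> S. {f B, u} \<in> G} = B" if "B \<in> Pow S" for B using f that by blast
    qed
    have all: "{f S, u} \<in> G" if "u \<in> S" for u using f that by blast
    have "S \<noteq> {}" using S(2) by auto
    show False
    proof (cases "S \<subseteq> {..<n}")
      case True
      obtain A where A: "A \<subseteq> S" "card A = a" by (metis S(2) ak(1) le_add1 obtain_subset_with_card_n)
      \<comment> \<open>Every set between \<open>A\<close> and \<open>S\<close> is the trace of a
        vertex adjacent to all of \<open>A\<close>; there are \<open>2 ^ k\<close> such sets because
        \<open>a + k = d + 1\<close>.\<close>
      define T where "T = (\<lambda>C. f (A \<union> C)) ` Pow (S - A)"
      have "inj_on (\<lambda>C. f (A \<union> C)) (Pow (S - A))"
      proof (rule inj_onI)
        fix C D assume CD: "C \<in> Pow (S - A)" "D \<in> Pow (S - A)" "f (A \<union> C) = f (A \<union> D)"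
        then have "A \<union> C = A \<union> D" using A(1) by (intro inj_onD[OF inj_f]) auto
        then show "C = D" using CD by blast
      qed
      then have "card T = 2 ^ card (S - A)"
        using S(3) by (simp add: T_def card_image card_Pow)
      also have "card (S - A) = k" using A S ak by (simp add: card_Diff_subset finite_subset)
      finally have T: "card T = 2 ^ k" .
      have AT: "{t, u} \<in> E \<and> t < n" if "t \<in> T" "u \<in> A" for t u
      proof -
        obtain C where "C \<subseteq> S - A" "t = f (A \<union> C)" using \<open>t \<in> T\<close> by (auto simp: T_def)
        then have "{t, u} \<in> G" using f[of "A \<union> C" u] \<open>u \<in> A\<close> A(1) by auto
        moreover have "u < n" using \<open>u \<in> A\<close> A(1) True by auto
        ultimately show ?thesis using low by blast
      qed
      \<comment> \<open>An element of \<open>A\<close> supplies the edges that place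
        \<open>T\<close> in the random piece; \<open>A\<close> and \<open>T\<close> are then
        disjoint because there are no loops.\<close>
      have "A \<noteq> {}" using A ak by auto
      then have "T \<subseteq> {..<n}" using AT by auto
      moreover have "A \<inter> T = {}" using AT E by fastforce
      moreover have "edges_between UNIV A T \<subseteq> E"
      proof
        fix e assume "e \<in> edges_between UNIV A T"
        then obtain u t where "u \<in> A" "t \<in> T" "e = {t, u}" by (auto simp: edges_between_def)
        then show "e \<in> E" using AT by blast
      qed
      ultimately show False using free[of A T] A T True by blast
    next
      case False
      \<comment> \<open>Otherwise \<open>f S\<close> would pull all its neighbors, hence all of
        \<open>S\<close>, into the random piece.\<close>
      have "f S \<ge> n" using low[of "f S"] all False by (meson lessThan_iff not_le subsetI)
      have edge: "{f B, u} \<in> gadget_edges n d" if "B \<subseteq> S" "u \<in> B" for B u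
      proof -
        have "u \<in> S" using that by blast
        then have "n \<le> u" using low[OF all] \<open>f S \<ge> n\<close> by force
        moreover have "{f B, u} \<in> G" using f that by blast
        ultimately show ?thesis using E by (auto simp: G_def)
      qed
      show False
      proof (cases "f S < n + d")
        case True
        \<comment> \<open>Here \<open>f S\<close> is a point, so \<open>S\<close> consists of set
          vertices, and the witnesses of the singletons are \<open>d + 1\<close> distinct
          points.\<close>
        have "f {u} \<in> (+) n ` {..<d}" if "u \<in> S" for u
        proof -
          have "{f S, u} \<in> gadget_edges n d" using edge that by blast
          then have "n + d \<le> u" using True by (auto simp: gadget_edges_def doubleton_eq_iff)
          moreover have "{f {u}, u} \<in> gadget_edges n d" using edge that by blast
          ultimately show ?thesis by (fastforce simp: gadget_edges_def doubleton_eq_iff)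
        qed
        then have "(\<lambda>u. f {u}) ` S \<subseteq> (+) n ` {..<d}" by auto
        moreover have "inj_on (\<lambda>u. f {u}) S"
          using inj_f by (auto simp: inj_on_def)
        ultimately have "card S \<le> card ((+) n ` {..<d})" by (intro card_inj_on_le) auto
        then show False using S(2) by (simp add: card_image)
      next
        case False
        \<comment> \<open>Here \<open>f S\<close> is a set vertex, and all its neighbors are
          points.\<close>
        have "S \<subseteq> (+) n ` {..<d}"
        proof
          fix u assume "u \<in> S"
          then have "{f S, u} \<in> gadget_edges n d" using edge by blast
          then show "u \<in> (+) n ` {..<d}"
            using False by (fastforce simp: gadget_edges_def doubleton_eq_iff)
        qed
        then have "card S \<le> card ((+) n ` {..<d})" by (intro card_mono) auto
        then show False using S(2) by (simp add: card_image)
      qed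
    qed
  qed
  ultimately show ?thesis unfolding has_vc_dim_def V_def[symmetric] G_def[symmetric] by blast
qed

section \<open>Equitable partitions\<close>

text \<open>Yields a lower bound on every part when there are few parts: no part is larger than
  \<open>card X + 1\<close>.\<close>

lemma card_le_equitable_partition:
  assumes "equitable_partition V P" "finite V" "X \<in> P"
  shows "card V \<le> card P * (card X + 1)"
proof -
  have P: "partition_on V P" using assms(1) by (simp add: equitable_partition_def)
  then have "V = \<Union>P" by (simp add: partition_on_def)
  also have "card (\<Union>P) = (\<Sum>Y\<in>P. card Y)"
  proof (rule card_Union_disjoint)
    show "pairwise disjnt P" using P by (auto simp: partition_on_def disjoint_def pairwise_def disjnt_def)
    show "finite Y" if "Y \<in> P" for Y
      using that \<open>V = \<Union>P\<close> assms(2) by (meson Sup_upper finite_subset)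
  qed
  also have "\<dots> \<le> card P * (card X + 1)"
    using assms(1,3) sum_bounded_above[of P card "card X + 1"] by (simp add: equitable_partition_def)
  finally show ?thesis .
qed

text \<open>A part with at most a tenth of its vertices in \<open>W\<close> behaves almost as its
  trace on \<open>R\<close>. The margin 5/4 in \<open>lower\<close> and the gap between 1/2 and
  \<open>1 - \<epsilon>\<close> absorb the loss.\<close>

lemma not_homogeneous_union:
  assumes eps: "0 < \<epsilon>" "\<epsilon> < 1 / 100"
    and ED: "\<forall>e\<in>E. e \<subseteq> R" "\<forall>e\<in>D. e \<subseteq> W" "R \<inter> W = {}"
    and X: "finite X" "X \<noteq> {}" "X \<subseteq> R \<union> W" "10 * card (X \<inter> W) \<le> card X"
    and Y: "finite Y" "Y \<noteq> {}" "Y \<subseteq> R \<union> W" "10 * card (Y \<inter> W) \<le> card Y"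
    and lower: "5 / 4 * \<epsilon> * (card (X \<inter> R) * card (Y \<inter> R)) < card (edges_between E (X \<inter> R) (Y \<inter> R))"
    and upper: "2 * card (edges_between E (X \<inter> R) (Y \<inter> R)) < card (X \<inter> R) * card (Y \<inter> R)"
  shows "\<not> homogeneous (E \<union> D) \<epsilon> X Y"
proof -
  let ?e = "real (card (edges_between (E \<union> D) X Y))" and ?e' = "real (card (edges_between E (X \<inter> R) (Y \<inter> R)))"
  let ?x = "real (card X)" and ?y = "real (card Y)"
  have split: "card Z = card (Z \<inter> R) + card (Z \<inter> W)" if "finite Z" "Z \<subseteq> R \<union> W" for Z
    using that ED(3) by (subst card_Un_disjoint[symmetric]) (auto intro: arg_cong[where f = card])
  have x: "9 / 10 * ?x \<le> card (X \<inter> R)" "real (card (X \<inter> R)) \<le> ?x" "real (card (X \<inter> W)) \<le> ?x / 10"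
    using split[OF X(1,3)] X(4) by linarith+
  have y: "9 / 10 * ?y \<le> card (Y \<inter> R)" "real (card (Y \<inter> R)) \<le> ?y" "real (card (Y \<inter> W)) \<le> ?y / 10"
    using split[OF Y(1,3)] Y(4) by linarith+
  have pos: "0 < ?x * ?y" using X(1,2) Y(1,2) by (simp add: card_gt_0_iff)
  have "?e' \<le> ?e"
    using X(1) Y(1) by (auto simp: edges_between_def intro!: card_mono finite_edges_between[unfolded edges_between_def])
  have "(9 / 10 * ?x) * (9 / 10 * ?y) \<le> real (card (X \<inter> R)) * real (card (Y \<inter> R))"
    using x y by (intro mult_mono) auto
  then have "5 / 4 * \<epsilon> * ((9 / 10 * ?x) * (9 / 10 * ?y)) \<le> 5 / 4 * \<epsilon> * (card (X \<inter> R) * card (Y \<inter> R))"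
    using eps by (intro mult_left_mono) auto
  \<comment> \<open>The constant is 5/4 times 81/100, slightly above 1.\<close>
  moreover have "\<epsilon> * (?x * ?y) \<le> 5 / 4 * \<epsilon> * ((9 / 10 * ?x) * (9 / 10 * ?y))"
    using eps pos by simp
  ultimately have "\<epsilon> * (?x * ?y) \<le> ?e" using lower \<open>?e' \<le> ?e\<close> by linarith
  moreover have "?e \<le> (1 - \<epsilon>) * (?x * ?y)"
  proof -
    \<comment> \<open>Edges lie inside \<open>R\<close> or inside \<open>W\<close>. Those inside
      \<open>W\<close> add at most 1/100 to the density, so it is at most 51/100.\<close>
    have "edges_between (E \<union> D) X Y
        \<subseteq> edges_between E (X \<inter> R) (Y \<inter> R) \<union> edges_between UNIV (X \<inter> W) (Y \<inter> W)"
      using ED by (fastforce simp: edges_between_def)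
    then have "card (edges_between (E \<union> D) X Y)
        \<le> card (edges_between E (X \<inter> R) (Y \<inter> R) \<union> edges_between UNIV (X \<inter> W) (Y \<inter> W))"
      using X(1) Y(1) by (intro card_mono) (auto intro: finite_edges_between)
    also have "\<dots> \<le> card (edges_between E (X \<inter> R) (Y \<inter> R)) + card (X \<inter> W) * card (Y \<inter> W)"
      using card_Un_le[of "edges_between E (X \<inter> R) (Y \<inter> R)" "edges_between UNIV (X \<inter> W) (Y \<inter> W)"]
        card_edges_between_UNIV_le[of "X \<inter> W" "Y \<inter> W"] X(1) Y(1) by simp
    finally have "?e \<le> ?e' + real (card (X \<inter> W)) * real (card (Y \<inter> W))"
      by (metis of_nat_add of_nat_le_iff of_nat_mult)
    moreover have "real (card (X \<inter> W)) * real (card (Y \<inter> W)) \<le> (?x / 10) * (?y / 10)"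
      using x y by (intro mult_mono) auto
    moreover have "2 * ?e' \<le> real (card (X \<inter> R)) * real (card (Y \<inter> R))"
      using upper by (metis less_imp_le of_nat_le_iff of_nat_mult of_nat_numeral)
    moreover have "real (card (X \<inter> R)) * real (card (Y \<inter> R)) \<le> ?x * ?y"
      using x y by (intro mult_mono) auto
    moreover have "99 / 100 * (?x * ?y) \<le> (1 - \<epsilon>) * (?x * ?y)"
      using eps pos by (intro mult_right_mono) auto
    moreover have "(?x / 10) * (?y / 10) = ?x * ?y / 100" by simp
    ultimately show ?thesis using pos by linarith
  qed
  ultimately have "\<epsilon> \<le> ?e / (?x * ?y)" "?e / (?x * ?y) \<le> 1 - \<epsilon>"
    using pos by (simp_all add: pos_le_divide_eq pos_divide_le_eq)
  then show ?thesis unfolding homogeneous_def edge_density_def by linarith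
qed

lemma not_almost_all_pairs_homogeneous:
  assumes "finite P" "\<epsilon> < 1"
    and "\<And>X Y. X \<in> P \<Longrightarrow> Y \<in> P \<Longrightarrow> X \<noteq> Y \<Longrightarrow> \<not> homogeneous E \<epsilon> X Y"
  shows "\<not> almost_all_pairs_homogeneous E \<epsilon> P"
proof
  assume *: "almost_all_pairs_homogeneous E \<epsilon> P"
  have "inhomogeneous_pairs E \<epsilon> P = part_pairs P"
    using assms(3) unfolding inhomogeneous_pairs_def part_pairs_def by blast
  \<comment> \<open>With no pairs the quotient would be 0 by the convention for division by zero;
    two parts rule this out, and the fraction is 1.\<close>
  moreover have "card (part_pairs P) \<noteq> 0"
  proof -
    have "2 \<le> card P" using * by (simp add: almost_all_pairs_homogeneous_def)
    then obtain X Y where "X \<in> P" "Y \<in> P" "X \<noteq> Y"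
      by (metis card_2_iff' obtain_subset_with_card_n subsetD)
    then have "{X, Y} \<in> part_pairs P" unfolding part_pairs_def by blast
    moreover have "finite (part_pairs P)"
      by (rule finite_subset[of _ "Pow P"]) (auto simp: part_pairs_def assms(1))
    ultimately show ?thesis by auto
  qed
  ultimately show False using * assms(2) by (simp add: almost_all_pairs_homogeneous_def)
qed

section \<open>Choice of parameters\<close>

lemma four_times_le_two_power:
  fixes m :: nat
  assumes "4 \<le> m"
  shows "4 * m \<le> 2 ^ m"
  using assms by (induction m rule: dec_induct) auto

text \<open>For about \<open>p ^ -(d / 2 + 1)\<close> vertices, the final inequality with
  \<open>b = 2 ^ k\<close> is what makes \<open>n ^ (a + b) * p ^ (a * b)\<close> at most 1.
  Choosing \<open>k = d div 4 + 2\<close> keeps \<open>2 * a\<close> above \<open>d + 2\<close>,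
  while \<open>2 ^ k\<close> is large enough to turn this slack into the inequality.\<close>

lemma biclique_sizes:
  fixes d :: nat
  assumes "16 \<le> d"
  obtains a k where "a + k = d + 1" "2 \<le> a" "(d + 2) * (a + 2 ^ k) \<le> 2 * a * 2 ^ k"
proof
  define m r where "m = d div 4" and "r = d mod 4"
  then have d: "d = 4 * m + r" and "4 \<le> m" "r \<le> 3" using assms by auto
  obtain j where j: "m = 4 + j" using \<open>4 \<le> m\<close> le_Suc_ex by blast
  \<comment> \<open>Substituting \<open>m = 4 + j\<close> afterwards eliminates the truncated
    subtraction.\<close>
  define a where "a = 3 * m + r - 1"
  have a: "a = 11 + 3 * j + r" unfolding a_def j by simp
  show "a + (m + 2) = d + 1" "2 \<le> a" using a j d by auto
  have b: "16 * m \<le> 2 ^ (m + 2)" using four_times_le_two_power[OF \<open>4 \<le> m\<close>] by simp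
  have "r = 0 \<or> r = 1 \<or> r = 2 \<or> r = 3" using \<open>r \<le> 3\<close> by auto
  \<comment> \<open>The factor \<open>4 + 2 * j + r\<close> is the slack
    \<open>2 * a - (d + 2)\<close>.\<close>
  then have "(d + 2) * a \<le> (4 + 2 * j + r) * (16 * m)"
    unfolding d j a by (elim disjE) (simp_all add: algebra_simps)
  also have "\<dots> \<le> (4 + 2 * j + r) * 2 ^ (m + 2)" using b by (rule mult_le_mono2)
  finally have "(d + 2) * a + (d + 2) * 2 ^ (m + 2) \<le> ((4 + 2 * j + r) + (d + 2)) * 2 ^ (m + 2)"
    by (simp only: add_mult_distrib)
  also have "(4 + 2 * j + r) + (d + 2) = 2 * a" unfolding d j a by simp
  finally show "(d + 2) * (a + 2 ^ (m + 2)) \<le> 2 * a * 2 ^ (m + 2)" by (simp only: add_mult_distrib2)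
qed

text \<open>Here \<open>k0\<close> is the claimed number of parts, so \<open>n / k0\<close> is
  roughly the size of a part. The bounds say that bicliques are rare, that the gadget is small
  compared with a part, and that the tail bounds apply to sets of size
  \<open>4 / 5 * (n / k0)\<close>.\<close>

lemma vertex_count:
  fixes d a b :: nat and \<epsilon> :: real
  defines "k0 \<equiv> (5 * \<epsilon>) powr (- (real d / 4))"
  assumes "16 \<le> d" and eps: "0 < \<epsilon>" "\<epsilon> < 1 / 100"
    and ab: "(d + 2) * (a + b) \<le> 2 * a * b"
  obtains n :: nat where "real n ^ (a + b) * (3 * \<epsilon>) ^ (a * b) \<le> 1"
    and "4 \<le> n" "0 < k0" "29 * 2 ^ d \<le> n / k0"
    and "3 * real n \<le> \<epsilon> * (4 / 5 * (n / k0))\<^sup>2 / 2"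
proof -
  \<comment> \<open>Fourth roots turn all estimates into comparisons of natural powers:
    \<open>k0 = y ^ d\<close>, and \<open>x ^ (2 * d + 4)\<close> is \<open>p ^ -(d / 2 + 1)\<close>
    for \<open>p = 3 * \<epsilon>\<close>.\<close>
  define x y where "x = (3 * \<epsilon>) powr (- 1 / 4)" and "y = (5 * \<epsilon>) powr (- 1 / 4)"
  have pos: "0 < x" "0 < y" using eps by (simp_all add: x_def y_def)
  have root4: "(z powr (- 1 / 4)) ^ 4 = 1 / z" if "0 < z" for z :: real
  proof -
    have "(z powr (- 1 / 4)) ^ 4 = (z powr (- 1 / 4)) powr real 4"
      using that by (subst powr_realpow) auto
    also have "\<dots> = z powr - 1" by (simp only: powr_powr) simp
    finally show ?thesis using that by (simp add: powr_minus_divide)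
  qed
  have x4: "x ^ 4 = 1 / (3 * \<epsilon>)" and y4: "y ^ 4 = 1 / (5 * \<epsilon>)"
    using root4[of "3 * \<epsilon>"] root4[of "5 * \<epsilon>"] eps by (simp_all add: x_def y_def)
  have k0: "k0 = y ^ d"
  proof -
    have "y ^ d = y powr real d" using pos by (simp add: powr_realpow)
    then show ?thesis by (simp add: k0_def y_def powr_powr)
  qed
  have x4_ge: "33 \<le> x ^ 4" and y4_ge: "1 \<le> y ^ 4" using eps by (simp_all add: x4 y4 field_simps)
  have xy4: "x ^ 4 = 5 / 3 * y ^ 4" using eps by (simp add: x4 y4)
  have y1: "1 \<le> y" using y4_ge pos by (smt (verit) one_le_power power_less_one_iff zero_less_numeral)
  have yx: "y \<le> x"
    by (rule power_le_imp_le_base[of _ 3]) (use xy4 y4_ge pos in \<open>simp_all add: numeral_eq_Suc\<close>)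
  then have x1: "1 \<le> x" using y1 by linarith
  \<comment> \<open>Its \<open>d\<close>-th power compares \<open>2 ^ d * k0\<close> with
    \<open>x ^ (2 * d)\<close>; the remaining \<open>x ^ 4 \<ge> 33\<close> supplies the
    constant.\<close>
  have "2 * y \<le> x ^ 2"
  proof (rule power_le_imp_le_base[of _ 3])
    have "(2 * y) ^ 4 = 16 * (3 / 5) * x ^ 4" using xy4 by (simp add: power_mult_distrib)
    also have "\<dots> \<le> x ^ 4 * x ^ 4" using x4_ge by (intro mult_right_mono) auto
    also have "\<dots> = (x ^ 2) ^ 4" by (simp flip: power_mult power_add)
    finally show "(2 * y) ^ Suc 3 \<le> (x ^ 2) ^ Suc 3" by simp
  qed simp
  then have "(2 * y) ^ d \<le> (x ^ 2) ^ d" using pos by (intro power_mono) auto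
  then have "33 * (2 * y) ^ d \<le> x ^ 4 * (x ^ 2) ^ d" using x4_ge pos by (intro mult_mono) auto
  also have "\<dots> = x ^ (2 * d + 4)" by (simp add: power_add power_mult)
  finally have L: "33 * 2 ^ d * k0 \<le> x ^ (2 * d + 4)" by (simp add: k0 power_mult_distrib)
  have k0_ge: "1 \<le> k0" unfolding k0 using y1 by (rule one_le_power)
  have "1 * 1 \<le> 2 ^ d * k0" using k0_ge by (intro mult_mono) auto
  then have L33: "33 \<le> x ^ (2 * d + 4)" using L by linarith
  \<comment> \<open>Rounding down costs at most a tenth, since the power is at least 33; this is why
    33 drops to 29 below.\<close>
  define n where "n = nat \<lfloor>x ^ (2 * d + 4)\<rfloor>"
  have n_le: "real n \<le> x ^ (2 * d + 4)" and "x ^ (2 * d + 4) < n + 1"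
    using L33 unfolding n_def by linarith+
  then have n_ge: "9 / 10 * x ^ (2 * d + 4) \<le> n" using L33 by linarith
  show ?thesis
  proof
    have "real n ^ (a + b) \<le> (x ^ (2 * d + 4)) ^ (a + b)" using n_le by (intro power_mono) auto
    also have "\<dots> = x ^ (2 * ((d + 2) * (a + b)))" by (simp add: power_mult[symmetric] algebra_simps)
    \<comment> \<open>By \<open>ab\<close> the exponent is at most \<open>4 * (a * b)\<close>, and
      each \<open>x ^ 4\<close> then cancels one factor \<open>3 * \<epsilon>\<close>.\<close>
    also have "\<dots> \<le> x ^ (4 * (a * b))" using ab x1 by (intro power_increasing) auto
    finally have "real n ^ (a + b) * (3 * \<epsilon>) ^ (a * b) \<le> (x ^ 4) ^ (a * b) * (3 * \<epsilon>) ^ (a * b)"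
      using eps by (intro mult_right_mono) (auto simp: power_mult)
    also have "\<dots> = (x ^ 4 * (3 * \<epsilon>)) ^ (a * b)" by (rule power_mult_distrib[symmetric])
    also have "x ^ 4 * (3 * \<epsilon>) = 1" using eps by (simp add: x4)
    finally show "real n ^ (a + b) * (3 * \<epsilon>) ^ (a * b) \<le> 1" by simp
    show "4 \<le> n" using n_ge L33 by linarith
    show "0 < k0" using k0_ge by linarith
    then have "29 * 2 ^ d * k0 \<le> 9 / 10 * (33 * 2 ^ d * k0)" by simp
    then have "29 * 2 ^ d * k0 \<le> n" using n_ge L by linarith
    then show "29 * 2 ^ d \<le> n / k0" using \<open>0 < k0\<close> by (simp add: field_simps)
    \<comment> \<open>Since \<open>16 \<le> d\<close>, the 32nd powers are available in
      \<open>x ^ (2 * d)\<close> and \<open>y ^ (2 * d)\<close>; the ratio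
      \<open>(5 / 3) ^ 8\<close> exceeds 59.\<close>
    have "(5 / 3) ^ 8 * (y ^ 4) ^ 8 = (x ^ 4) ^ 8"
      unfolding xy4 by (rule power_mult_distrib[symmetric])
    then have "(5 / 3) ^ 8 * y ^ 32 = x ^ 32" by (simp flip: power_mult)
    moreover have "59 * y ^ 32 \<le> (5 / 3) ^ 8 * y ^ 32"
      using pos by (intro mult_right_mono) (auto simp: power_divide)
    ultimately have "59 * y ^ 32 \<le> x ^ 32" by linarith
    moreover have "y ^ (2 * d - 32) \<le> x ^ (2 * d - 32)" using yx pos by (intro power_mono) auto
    ultimately have "59 * y ^ 32 * y ^ (2 * d - 32) \<le> x ^ 32 * x ^ (2 * d - 32)"
      using pos by (intro mult_mono) auto
    then have "59 * y ^ (2 * d) \<le> x ^ (2 * d)"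
      using \<open>16 \<le> d\<close> by (simp add: mult.assoc flip: power_add)
    moreover have "y ^ (2 * d) = k0\<^sup>2" by (simp add: k0 mult.commute flip: power_mult)
    moreover have "\<epsilon> * (9 / 10 * x ^ (2 * d + 4)) = 3 / 10 * x ^ (2 * d)"
      using eps by (simp add: power_add x4)
    moreover have "\<epsilon> * (9 / 10 * x ^ (2 * d + 4)) \<le> \<epsilon> * n" using n_ge eps by simp
    moreover have "0 \<le> k0\<^sup>2" by simp
    \<comment> \<open>The constant is 3 times 2 times 25/16, from solving the final inequality for
      \<open>\<epsilon> * n\<close>.\<close>
    ultimately have "75 / 8 * k0\<^sup>2 \<le> \<epsilon> * n" by linarith
    then have "real n * (75 / 8 * k0\<^sup>2) \<le> real n * (\<epsilon> * n)" by (intro mult_left_mono) auto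
    then show "3 * real n \<le> \<epsilon> * (4 / 5 * (n / k0))\<^sup>2 / 2"
      using \<open>0 < k0\<close> by (simp add: field_simps power2_eq_square)
  qed
qed

section \<open>Assembly of the graph and the bound on the number of parts\<close>

theorem theorem4:
  fixes d :: nat and \<epsilon> :: real
  assumes "d \<ge> 16" and "0 < \<epsilon>" and "\<epsilon> < 1 / 100"
  shows "\<exists>(V :: nat set) E. finite_simple_graph V E \<and> has_vc_dim V E d \<and>
    (\<forall>P. equitable_partition V P \<and> almost_all_pairs_homogeneous E \<epsilon> P \<longrightarrow>
         real (card P) \<ge> (5 * \<epsilon>) powr (- (real d / 4)))"
proof -
  define k0 where "k0 = (5 * \<epsilon>) powr (- (real d / 4))"
  obtain a k where ak: "a + k = d + 1" "2 \<le> a" "(d + 2) * (a + 2 ^ k) \<le> 2 * a * 2 ^ k"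
    using biclique_sizes[OF assms(1)] by blast
  obtain n :: nat where n: "real n ^ (a + 2 ^ k) * (3 * \<epsilon>) ^ (a * 2 ^ k) \<le> 1"
    "4 \<le> n" "0 < k0" "29 * 2 ^ d \<le> n / k0" "3 * real n \<le> \<epsilon> * (4 / 5 * (n / k0))\<^sup>2 / 2"
    using vertex_count[OF assms ak(3)] unfolding k0_def by blast
  have s0: "0 \<le> 4 / 5 * (n / k0)" using n(3) by simp
  obtain E where E: "\<forall>e\<in>E. e \<subseteq> {..<n} \<and> card e = 2"
    and free: "\<And>A T. A \<subseteq> {..<n} \<Longrightarrow> T \<subseteq> {..<n} \<Longrightarrow> A \<inter> T = {} \<Longrightarrow> card A = a \<Longrightarrow> card T = 2 ^ k \<Longrightarrow>
      \<not> edges_between UNIV A T \<subseteq> E"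
    and density: "\<And>X Y. X \<subseteq> {..<n} \<Longrightarrow> Y \<subseteq> {..<n} \<Longrightarrow> X \<inter> Y = {} \<Longrightarrow>
      4 / 5 * (n / k0) \<le> card X \<Longrightarrow> 4 / 5 * (n / k0) \<le> card Y \<Longrightarrow>
      5 / 4 * \<epsilon> * (card X * card Y) < card (edges_between E X Y) \<and>
      2 * card (edges_between E X Y) < card X * card Y"
    by (rule exists_random_graph[OF assms(2,3) ak(2) n(2) s0 n(1,5)]) (rule that; blast)
  define R where "R = {..<n}"
  define W where "W = gadget_vertices n d"
  define D where "D = gadget_edges n d"
  have RW: "finite R" "finite W" "R \<inter> W = {}" "card R = n" "card W \<le> d + 2 ^ d"
    using gadget_vertices_disjoint[of n d] finite_gadget_vertices[of n d] card_gadget_vertices_le[of n d]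
    by (auto simp: R_def W_def)
  have D: "\<forall>e\<in>D. e \<subseteq> W \<and> card e = 2" using gadget_edges_doubleton by (auto simp: D_def W_def)
  have "finite_simple_graph (R \<union> W) (E \<union> D)"
    using RW E D by (auto simp: finite_simple_graph_def R_def)
  moreover have "has_vc_dim (R \<union> W) (E \<union> D) d"
    unfolding R_def W_def D_def by (rule has_vc_dim_gadget[OF E ak(1)]) (use ak(2) free in auto)
  moreover have "k0 \<le> card P"
    if P: "equitable_partition (R \<union> W) P" "almost_all_pairs_homogeneous (E \<union> D) \<epsilon> P" for P
  proof (rule ccontr)
    assume less: "\<not> k0 \<le> card P"
    have part: "partition_on (R \<union> W) P" using P(1) by (simp add: equitable_partition_def)
    have cardP: "2 \<le> card P" using P(2) by (simp add: almost_all_pairs_homogeneous_def)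
    \<comment> \<open>With fewer than \<open>k0\<close> parts, \<open>card X + 1\<close> is at least
      \<open>n / k0\<close>, hence at least \<open>29 * 2 ^ d\<close>. The gadget has at most
      \<open>2 * 2 ^ d\<close> vertices, which is below a tenth of \<open>card X\<close>. Removing
      it, together with the 1, costs at most \<open>3 * 2 ^ d\<close>, less than a fifth of
      \<open>n / k0\<close>.\<close>
    have sizes: "finite X \<and> X \<noteq> {} \<and> X \<subseteq> R \<union> W \<and> 10 * card (X \<inter> W) \<le> card X \<and>
      4 / 5 * (n / k0) \<le> card (X \<inter> R)" if "X \<in> P" for X
    proof -
      have X: "X \<subseteq> R \<union> W" "X \<noteq> {}" using part that by (auto simp: partition_on_def)
      then have "finite X" using RW finite_subset by blast
      have "n \<le> card (R \<union> W)" using RW by (metis card_mono finite_UnI sup_ge1)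
      also have "\<dots> \<le> card P * (card X + 1)"
        using RW by (intro card_le_equitable_partition[OF P(1) _ that]) auto
      finally have "real n \<le> real (card P) * (card X + 1)" by (metis of_nat_le_iff of_nat_mult)
      also have "\<dots> \<le> k0 * (card X + 1)" using less by (intro mult_right_mono) auto
      finally have "n / k0 \<le> card X + 1" using n(3) by (simp add: field_simps)
      moreover have "real d \<le> 2 ^ d" using less_exp[of d] by (metis less_imp_le of_nat_le_iff of_nat_numeral of_nat_power)
      moreover have "real (card (X \<inter> W)) \<le> real d + 2 ^ d"
      proof -
        have "card (X \<inter> W) \<le> d + 2 ^ d" using RW card_mono[of W "X \<inter> W"] by auto
        then show ?thesis by (metis of_nat_add of_nat_le_iff of_nat_numeral of_nat_power)
      qed
      moreover have "card X = card (X \<inter> R) + card (X \<inter> W)"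
        using X RW \<open>finite X\<close> by (subst card_Un_disjoint[symmetric]) (auto intro: arg_cong[where f = card])
      moreover have "1 \<le> (2::real) ^ d" by simp
      ultimately have W: "10 * real (card (X \<inter> W)) \<le> card X" "4 / 5 * (n / k0) \<le> card (X \<inter> R)"
        using n(4) by linarith+
      then show ?thesis using X \<open>finite X\<close> by linarith
    qed
    have "\<not> homogeneous (E \<union> D) \<epsilon> X Y" if "X \<in> P" "Y \<in> P" "X \<noteq> Y" for X Y
    proof -
      have "X \<inter> Y = {}" using part that by (auto simp: partition_on_def disjoint_def)
      then have "5 / 4 * \<epsilon> * (card (X \<inter> R) * card (Y \<inter> R)) < card (edges_between E (X \<inter> R) (Y \<inter> R)) \<and>
        2 * card (edges_between E (X \<inter> R) (Y \<inter> R)) < card (X \<inter> R) * card (Y \<inter> R)"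
        using sizes[OF that(1)] sizes[OF that(2)] by (intro density) (auto simp: R_def)
      then show ?thesis
        using sizes[OF that(1)] sizes[OF that(2)] E D RW(3) assms(2,3)
        by (intro not_homogeneous_union[where R = R and W = W]) (auto simp: R_def)
    qed
    \<comment> \<open>An infinite family would have \<open>card\<close> equal to 0.\<close>
    moreover have "finite P" using cardP by (metis card.infinite not_numeral_le_zero)
    ultimately show False
      using not_almost_all_pairs_homogeneous[of P \<epsilon> "E \<union> D"] P(2) assms(3) by auto
  qed
  ultimately show ?thesis unfolding k0_def by blast
qed

end
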